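(* Let $q$ be a prime power and $0<k<n$, $0\le t\le k$ integers. The inclusion map $\iota:\mathcal{P}_t(n,k)\to\mathcal{G}(n,k)$ is a transparent embedding.
   Context: Let $V=\mathbb{F}_q^n$ with its standard basis. An $[n,m]$-linear code is an $m$-dimensional subspace of $V$; $\mathcal{C}_t(n,m)$ denotes the set of $[n,m]$-codes such that any $t$ columns of a generator matrix (an $m\times n$ matrix whose rows form a basis) are linearly independent. The $k$-Grassmann geometry $\mathcal{G}(n,k)$ is the point-line geometry whose points are the $k$-dimensional subspaces of $V$ and whose lines are the sets $\ell_{X,Y}=\{Z:\dim Z=k,\ X\subset Z\subset Y\}$ with $\dim X=k-1$, $\dim Y=k+1$ (if $k<n-1$), respectively $\ell_X=\{Z:\dim Z=n-1,\ X\subset Z\}$ with $\dim X=n-2$ (if $k=n-1$). The geometry $\mathcal{P}_t(n,k)$ has point set $\mathcal{C}_t(n,k)$ and lines $\ell_{X,Y}=\{Z\in\mathcal{C}_t(n,k): X\subset Z\subset Y\}$ with $X\in\mathcal{C}_t(n,k-1)$, $Y\in\mathcal{C}_t(n,k+1)$ (if $k<n-1$), respectively $\ell_X=\{Z\in\mathcal{C}_t(n,n-1):X\subset Z\}$ with $X\in\mathcal{C}_t(n,n-2)$ (if $k=n-1$). An injective map $\varepsilon$ from the points of a point-line geometry $\mathcal{G}_1$ to the points of $\mathcal{G}_2$ is an embedding if the image of every line of $\mathcal{G}_1$ is a line of $\mathcal{G}_2$; it is transparent if moreover the preimage of any line of $\mathcal{G}_2$ contained in the image of $\varepsilon$ is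 a line of $\mathcal{G}_1$. *)

theory Defs
  imports "HOL-Analysis.Cartesian_Space"
begin

text \<open>
  The space \<open>V = F\<^sub>q\<^sup>n\<close> is the type \<open>'a ^ 'n\<close> with \<open>'a\<close> a finite field, \<open>q = CARD('a)\<close>
  and \<open>n = CARD('n)\<close>.
\<close>

definition linear_codes :: "nat \<Rightarrow> ('a::{field,finite} ^ 'n) set set" where
  "linear_codes m = {C. vec.subspace C \<and> vec.dim C = m}"

text \<open>
  An \<open>m \<times> n\<close> matrix with \<open>m\<close> an arbitrary natural number (possibly 0) is represented by its
  rows \<open>G 0, \<dots>, G (m - 1)\<close>; the values \<open>G i\<close> for \<open>i \<ge> m\<close> are irrelevant.
\<close>

definition generator_matrix :: "nat \<Rightarrow> (nat \<Rightarrow> 'a::{field,finite} ^ 'n) \<Rightarrow> ('a ^ 'n) set \<Rightarrow> bool" where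
  "generator_matrix m G C \<longleftrightarrow>
     inj_on G {..<m} \<and> vec.independent (G ` {..<m}) \<and> vec.span (G ` {..<m}) = C"

text \<open>
  Linear independence in \<open>F\<^sub>q\<^sup>m\<close> of the columns with index in \<open>J\<close>, as a family: equal columns
  at different positions are dependent.
\<close>

definition columns_independent :: "nat \<Rightarrow> (nat \<Rightarrow> 'a::{field,finite} ^ 'n) \<Rightarrow> 'n set \<Rightarrow> bool" where
  "columns_independent m G J \<longleftrightarrow>
     (\<forall>c :: 'n \<Rightarrow> 'a. (\<forall>i<m. (\<Sum>j\<in>J. c j * G i $ j) = 0) \<longrightarrow> (\<forall>j\<in>J. c j = 0))"

definition codes_t :: "nat \<Rightarrow> nat \<Rightarrow> ('a::{field,finite} ^ 'n) set set" where
  "codes_t t m = {C \<in> linear_codes m.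
     \<exists>G. generator_matrix m G C \<and> (\<forall>J. card J = t \<longrightarrow> columns_independent m G J)}"

record 'p point_line_geometry =
  points :: "'p set"
  lines :: "'p set set"

text \<open>
  In a line \<open>\<ell>\<^sub>X\<^sub>,\<^sub>Y\<close> the condition \<open>X \<subseteq> Y\<close> is made explicit, so that the empty set is not a line.
\<close>

definition grassmann_geometry :: "nat \<Rightarrow> ('a::{field,finite} ^ 'n) set point_line_geometry" where
  "grassmann_geometry k = \<lparr>
     points = {Z. vec.subspace Z \<and> vec.dim Z = k},
     lines =
       (if k < CARD('n) - 1 then
          {{Z. vec.subspace Z \<and> vec.dim Z = k \<and> X \<subseteq> Z \<and> Z \<subseteq> Y} | X Y.
             vec.subspace X \<and> vec.dim X = k - 1 \<and> vec.subspace Y \<and> vec.dim Y = k + 1 \<and> X \<subseteq> Y}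
        else if k = CARD('n) - 1 then
          {{Z. vec.subspace Z \<and> vec.dim Z = CARD('n) - 1 \<and> X \<subseteq> Z} | X.
             vec.subspace X \<and> vec.dim X = CARD('n) - 2}
        else {})\<rparr>"

definition code_geometry :: "nat \<Rightarrow> nat \<Rightarrow> ('a::{field,finite} ^ 'n) set point_line_geometry" where
  "code_geometry t k = \<lparr>
     points = codes_t t k,
     lines =
       (if k < CARD('n) - 1 then
          {{Z \<in> codes_t t k. X \<subseteq> Z \<and> Z \<subseteq> Y} | X Y.
             X \<in> codes_t t (k - 1) \<and> Y \<in> codes_t t (k + 1) \<and> X \<subseteq> Y}
        else if k = CARD('n) - 1 then
          {{Z \<in> codes_t t (CARD('n) - 1). X \<subseteq> Z} | X. X \<in> codes_t t (CARD('n) - 2)}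
        else {})\<rparr>"

definition geometry_embedding ::
    "('p \<Rightarrow> 'r) \<Rightarrow> 'p point_line_geometry \<Rightarrow> 'r point_line_geometry \<Rightarrow> bool" where
  "geometry_embedding e \<G>\<^sub>1 \<G>\<^sub>2 \<longleftrightarrow>
     e ` points \<G>\<^sub>1 \<subseteq> points \<G>\<^sub>2 \<and> inj_on e (points \<G>\<^sub>1) \<and>
     (\<forall>l \<in> lines \<G>\<^sub>1. e ` l \<in> lines \<G>\<^sub>2)"

definition transparent_embedding ::
    "('p \<Rightarrow> 'r) \<Rightarrow> 'p point_line_geometry \<Rightarrow> 'r point_line_geometry \<Rightarrow> bool" where
  "transparent_embedding e \<G>\<^sub>1 \<G>\<^sub>2 \<longleftrightarrow>
     geometry_embedding e \<G>\<^sub>1 \<G>\<^sub>2 \<and>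
     (\<forall>l \<in> lines \<G>\<^sub>2. l \<subseteq> e ` points \<G>\<^sub>1 \<longrightarrow> {p \<in> points \<G>\<^sub>1. e p \<in> l} \<in> lines \<G>\<^sub>1)"

end

theory Submission
  imports Defs
begin

text \<open>
  A \<open>k\<close>-dimensional code lies in \<open>codes_t t k\<close> iff no nonzero functional supported on \<open>t\<close>
  coordinates vanishes on it, a property inherited by larger codes. Hence every Grassmann line
  through \<open>X\<close> with \<open>X \<in> codes_t t (k - 1)\<close> lies in \<open>codes_t t k\<close>. Conversely, if such a functional
  \<open>f\<close> vanishes on \<open>X\<close>, then \<open>Y \<inter> ker f\<close> has dimension at least \<open>k\<close> and contains \<open>X\<close>, so the line
  from \<open>X\<close> to \<open>Y\<close> has a point on which \<open>f\<close> vanishes and which therefore is not in \<open>codes_t t k\<close>.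
\<close>

text \<open>The coordinate functionals indexed by \<open>J\<close> are linearly independent on
  \<open>C\<close>; equivalently, the dual code has no nonzero word supported in \<open>J\<close>.
  No generator matrix is involved.\<close>

definition coordinates_independent :: "('a::{field,finite} ^ 'n) set \<Rightarrow> 'n set \<Rightarrow> bool" where
  "coordinates_independent C J \<longleftrightarrow>
     (\<forall>c. (\<forall>x\<in>C. (\<Sum>j\<in>J. c j * x $ j) = 0) \<longrightarrow> (\<forall>j\<in>J. c j = 0))"

lemma coordinates_independent_mono:
  "coordinates_independent C J \<Longrightarrow> C \<subseteq> D \<Longrightarrow> coordinates_independent D J"
  unfolding coordinates_independent_def by blast

lemma subspace_functional_kernel:
  fixes c :: "'n::finite \<Rightarrow> 'a::{field,finite}"
  shows "vec.subspace {x :: 'a ^ 'n. (\<Sum>j\<in>J. c j * x $ j) = 0}"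
proof (rule vec.subspaceI)
  fix a and x :: "'a ^ 'n"
  have "(\<Sum>j\<in>J. c j * (a *s x) $ j) = a * (\<Sum>j\<in>J. c j * x $ j)"
    by (simp add: sum_distrib_left mult.left_commute)
  then show "x \<in> {x. (\<Sum>j\<in>J. c j * x $ j) = 0} \<Longrightarrow> a *s x \<in> {x. (\<Sum>j\<in>J. c j * x $ j) = 0}"
    by simp
qed (auto simp: distrib_left sum.distrib)

text \<open>A functional vanishes on \<open>C\<close> as soon as it vanishes on the rows of
  \<open>G\<close>, which span \<open>C\<close>, so both sides test the same families
  \<open>c\<close>.\<close>

lemma columns_independent_iff:
  assumes "generator_matrix m G C"
  shows "columns_independent m G J \<longleftrightarrow> coordinates_independent C J"
proof -
  have "(\<forall>i<m. (\<Sum>j\<in>J. c j * G i $ j) = 0) \<longleftrightarrow> (\<forall>x\<in>C. (\<Sum>j\<in>J. c j * x $ j) = 0)" for c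
  proof -
    let ?K = "{x. (\<Sum>j\<in>J. c j * x $ j) = 0}"
    have C: "vec.span (G ` {..<m}) = C"
      using assms unfolding generator_matrix_def by blast
    have "G ` {..<m} \<subseteq> ?K \<longleftrightarrow> C \<subseteq> ?K"
    proof
      show "C \<subseteq> ?K" if "G ` {..<m} \<subseteq> ?K"
        using vec.span_minimal[OF that subspace_functional_kernel] unfolding C .
      show "G ` {..<m} \<subseteq> ?K" if "C \<subseteq> ?K"
        using that vec.span_superset unfolding C[symmetric] by (rule subset_trans[rotated])
    qed
    then show ?thesis by auto
  qed
  then show ?thesis
    unfolding columns_independent_def coordinates_independent_def by simp
qed

lemma generator_matrix_exists:
  assumes "C \<in> linear_codes m"
  shows "\<exists>G. generator_matrix m G C"
proof -
  have C: "vec.subspace C" "vec.dim C = m"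
    using assms by (auto simp: linear_codes_def)
  obtain B where B: "B \<subseteq> C" "vec.independent B" "C \<subseteq> vec.span B" "card B = m"
    using vec.basis_exists[of C] C by auto
  have "finite B" by simp
  then obtain G where "bij_betw G {..<m} B"
    using ex_bij_betw_nat_finite[of B] B(4) by (auto simp: atLeast0LessThan)
  moreover have "vec.span B = C"
    using B C vec.span_minimal by blast
  ultimately show ?thesis
    using B unfolding generator_matrix_def bij_betw_def by auto
qed

text \<open>All generator matrices of a code pass or fail the column test together, so the
  existential over \<open>G\<close> only asks that one exists.\<close>

lemma codes_t_eq:
  "codes_t t m = {C \<in> linear_codes m. \<forall>J. card J = t \<longrightarrow> coordinates_independent C J}"
  unfolding codes_t_def using columns_independent_iff generator_matrix_exists by fast

lemma codes_t_mono:
  assumes "C \<in> codes_t t m" "C \<subseteq> D" "vec.subspace D" "vec.dim D = d"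
  shows "D \<in> codes_t t d"
  using assms coordinates_independent_mono unfolding codes_t_eq linear_codes_def by blast

text \<open>By \<open>codes_t_mono\<close>, a Grassmann line above a code \<open>X\<close> loses no
  point on passing to \<open>codes_t\<close>. With \<open>Y\<close> arbitrary, \<open>UNIV\<close>
  can serve as upper bound for hyperplanes.\<close>

lemma points_between_eq:
  assumes "X \<in> codes_t t m"
  shows "{Z \<in> codes_t t k. X \<subseteq> Z \<and> Z \<subseteq> Y} =
    {Z. vec.subspace Z \<and> vec.dim Z = k \<and> X \<subseteq> Z \<and> Z \<subseteq> Y}"
  using codes_t_mono[OF assms] by (auto simp: codes_t_def linear_codes_def)

lemma exists_subspace_between:
  fixes X :: "('a::{field,finite} ^ 'n) set"
  assumes "vec.subspace X" "vec.subspace W" "X \<subseteq> W" "vec.dim X < vec.dim W"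
  shows "\<exists>Z. vec.subspace Z \<and> vec.dim Z = vec.dim X + 1 \<and> X \<subseteq> Z \<and> Z \<subseteq> W"
proof -
  obtain v where v: "v \<in> W" "v \<notin> X"
    using assms by (metis order_less_irrefl subset_antisym subsetI)
  let ?Z = "vec.span (insert v X)"
  have "v \<notin> vec.span X"
    using assms(1) v(2) by (metis vec.span_eq_iff)
  then have "vec.dim ?Z = vec.dim X + 1"
    using v by (simp add: vec.dim_insert)
  moreover have "X \<subseteq> ?Z"
    using vec.span_superset by blast
  moreover have "?Z \<subseteq> W"
    using v assms by (intro vec.span_minimal) auto
  ultimately show ?thesis
    using vec.subspace_span by blast
qed

text \<open>If the functional is nonzero at some \<open>y\<close> in \<open>Y\<close>, then
  \<open>y\<close> together with the kernel spans \<open>Y\<close>.\<close>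

lemma dim_inter_functional_kernel:
  fixes Y :: "('a::{field,finite} ^ 'n::finite) set" and c :: "'n \<Rightarrow> 'a"
  assumes "vec.subspace Y"
  shows "vec.dim Y \<le> vec.dim (Y \<inter> {x. (\<Sum>j\<in>J. c j * x $ j) = 0}) + 1"
proof (cases "Y \<subseteq> {x. (\<Sum>j\<in>J. c j * x $ j) = 0}")
  case True
  then show ?thesis by (simp add: Int_absorb2)
next
  case False
  define f where "f x = (\<Sum>j\<in>J. c j * x $ j)" for x :: "'a ^ 'n"
  let ?K = "Y \<inter> {x. f x = 0}"
  obtain y where y: "y \<in> Y" "f y \<noteq> 0"
    using False unfolding f_def by blast
  have "x \<in> vec.span (insert y ?K)" if "x \<in> Y" for x
  proof -
    \<comment> \<open>This multiple of \<open>y\<close> has the same value under \<open>f\<close> as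
      \<open>x\<close>, so the difference lies in the kernel.\<close>
    let ?a = "f x / f y"
    have "f (x - ?a *s y) = f x - ?a * f y"
      unfolding f_def
      by (simp add: right_diff_distrib sum_subtractf sum_distrib_left mult.left_commute)
    also have "\<dots> = 0"
      using y by simp
    finally have "x - ?a *s y \<in> ?K"
      using that y assms by (auto intro: vec.subspace_diff vec.subspace_scale)
    then have "x - ?a *s y \<in> vec.span ?K"
      by (rule vec.span_base)
    then show ?thesis
      unfolding vec.span_insert by blast
  qed
  then have "vec.dim Y \<le> vec.dim (insert y ?K)"
    by (metis subsetI vec.dim_span vec.dim_subset)
  also have "\<dots> \<le> vec.dim ?K + 1"
    by (simp add: vec.dim_insert)
  finally show ?thesis
    unfolding f_def .
qed

text \<open>This is the transparency half: the ends of a Grassmann line are codes of the right kind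
  once all its points are. Writing \<open>m\<close> for \<open>k - 1\<close> avoids truncated
  subtraction.\<close>

lemma codes_t_of_points_between:
  fixes X Y :: "('a::{field,finite} ^ 'n) set"
  assumes X: "vec.subspace X" "vec.dim X = m"
    and Y: "vec.subspace Y" "vec.dim Y = m + 2" and "X \<subseteq> Y"
    and line: "\<And>Z. vec.subspace Z \<Longrightarrow> vec.dim Z = m + 1 \<Longrightarrow> X \<subseteq> Z \<Longrightarrow> Z \<subseteq> Y \<Longrightarrow> Z \<in> codes_t t (m + 1)"
  shows "X \<in> codes_t t m" and "Y \<in> codes_t t (m + 2)"
proof -
  \<comment> \<open>The line is nonempty, and \<open>Y\<close> inherits the property from any of its
    points.\<close>
  obtain Z where "vec.subspace Z" "vec.dim Z = m + 1" "X \<subseteq> Z" "Z \<subseteq> Y"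
    using exists_subspace_between[of X Y] X Y \<open>X \<subseteq> Y\<close> by auto
  then show "Y \<in> codes_t t (m + 2)"
    using line codes_t_mono Y by blast
  have "coordinates_independent X J" if "card J = t" for J
    unfolding coordinates_independent_def
  proof (intro allI impI)
    fix c assume c: "\<forall>x\<in>X. (\<Sum>j\<in>J. c j * x $ j) = 0"
    let ?W = "Y \<inter> {x. (\<Sum>j\<in>J. c j * x $ j) = 0}"
    have "vec.subspace ?W"
      using Y(1) subspace_functional_kernel by (rule vec.subspace_inter)
    moreover have "X \<subseteq> ?W"
      using c \<open>X \<subseteq> Y\<close> by blast
    \<comment> \<open>Cutting \<open>Y\<close> by one functional costs at most one of its
      \<open>m + 2\<close> dimensions.\<close>
    moreover have "vec.dim X < vec.dim ?W"
      using dim_inter_functional_kernel[OF Y(1), of c J] X Y by linarith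
    ultimately obtain Z where Z: "vec.subspace Z" "vec.dim Z = m + 1" "X \<subseteq> Z" "Z \<subseteq> ?W"
      using exists_subspace_between[of X ?W] X by auto
    \<comment> \<open>\<open>Z\<close> is a point of the line on which \<open>c\<close> vanishes,
      which forces \<open>c\<close> to be zero on \<open>J\<close>.\<close>
    then have "coordinates_independent Z J"
      using line[of Z] that by (auto simp: codes_t_eq)
    then show "\<forall>j\<in>J. c j = 0"
      using Z(4) unfolding coordinates_independent_def by blast
  qed
  then show "X \<in> codes_t t m"
    using X by (simp add: codes_t_eq linear_codes_def)
qed

theorem theorem1p11:
  fixes k t :: nat
  assumes "0 < k" and "k < CARD('n::finite)" and "t \<le> k"
  shows "transparent_embedding (\<lambda>Z. Z)
           (code_geometry t k :: ('a::{field,finite} ^ 'n) set point_line_geometry)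
           (grassmann_geometry k)"
proof -
  let ?P = "code_geometry t k :: ('a ^ 'n) set point_line_geometry"
  let ?G = "grassmann_geometry k :: ('a ^ 'n) set point_line_geometry"
  have points: "points ?P = codes_t t k" "points ?P \<subseteq> points ?G"
    by (auto simp: code_geometry_def grassmann_geometry_def codes_t_def linear_codes_def)
  \<comment> \<open>For the inclusion map, images and preimages of the relevant lines are the lines
    themselves, so both conditions compare sets of lines.\<close>
  have "lines ?P \<subseteq> lines ?G \<and> (\<forall>l\<in>lines ?G. l \<subseteq> codes_t t k \<longrightarrow> l \<in> lines ?P)"
  proof (cases "k < CARD('n) - 1")
    case True
    define L where "L X Y = {Z. vec.subspace Z \<and> vec.dim Z = k \<and> X \<subseteq> Z \<and> Z \<subseteq> Y}"
      for X Y :: "('a ^ 'n) set"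
    have P: "lines ?P = {L X Y | X Y. X \<in> codes_t t (k - 1) \<and> Y \<in> codes_t t (k + 1) \<and> X \<subseteq> Y}"
    proof -
      define M where "M X Y = {Z \<in> codes_t t k. X \<subseteq> Z \<and> Z \<subseteq> Y}" for X Y :: "('a ^ 'n) set"
      have "M X Y = L X Y" if "X \<in> codes_t t (k - 1)" for X Y
        using points_between_eq[OF that] unfolding L_def M_def .
      moreover have "lines ?P =
          {M X Y | X Y. X \<in> codes_t t (k - 1) \<and> Y \<in> codes_t t (k + 1) \<and> X \<subseteq> Y}"
        using True unfolding code_geometry_def M_def by simp
      ultimately show ?thesis
        by (simp only:) (intro Collect_cong ex_cong1, auto)
    qed
    have G: "lines ?G = {L X Y | X Y. vec.subspace X \<and> vec.dim X = k - 1 \<and>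
        vec.subspace Y \<and> vec.dim Y = k + 1 \<and> X \<subseteq> Y}"
      using True unfolding grassmann_geometry_def L_def by simp
    have "X \<in> codes_t t (k - 1) \<and> Y \<in> codes_t t (k + 1)"
      if "vec.subspace X" "vec.dim X = k - 1" "vec.subspace Y" "vec.dim Y = k + 1" "X \<subseteq> Y"
        "L X Y \<subseteq> codes_t t k" for X Y
      \<comment> \<open>Positivity of \<open>k\<close> turns \<open>k - 1 + 1\<close> and
        \<open>k - 1 + 2\<close> into \<open>k\<close> and \<open>k + 1\<close>.\<close>
      using codes_t_of_points_between[of X "k - 1" Y t] that \<open>0 < k\<close> unfolding L_def by auto
    then have "\<forall>l\<in>lines ?G. l \<subseteq> codes_t t k \<longrightarrow> l \<in> lines ?P"
      unfolding P G by blast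
    moreover have "lines ?P \<subseteq> lines ?G"
      unfolding P G codes_t_def linear_codes_def by blast
    ultimately show ?thesis by blast
  next
    case False
    then have k: "k = CARD('n) - 1" "k - 1 = CARD('n) - 2"
      using assms by auto
    define L where "L X = {Z. vec.subspace Z \<and> vec.dim Z = k \<and> X \<subseteq> Z}"
      for X :: "('a ^ 'n) set"
    have P: "lines ?P = {L X | X. X \<in> codes_t t (k - 1)}"
    proof -
      define M where "M X = {Z \<in> codes_t t k. X \<subseteq> Z}" for X :: "('a ^ 'n) set"
      have "M X = L X" if "X \<in> codes_t t (k - 1)" for X
        using points_between_eq[OF that, of k UNIV] unfolding L_def M_def by simp
      moreover have "lines ?P = {M X | X. X \<in> codes_t t (k - 1)}"
        using False k unfolding code_geometry_def M_def by simp
      ultimately show ?thesis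
        by (simp only:) (intro Collect_cong ex_cong1, auto)
    qed
    have G: "lines ?G = {L X | X. vec.subspace X \<and> vec.dim X = k - 1}"
      using False k unfolding grassmann_geometry_def L_def by simp
    \<comment> \<open>For hyperplanes the whole space takes the place of \<open>Y\<close>, so the
      same lemma applies to \<open>X\<close>.\<close>
    have "vec.dim (UNIV :: ('a ^ 'n) set) = k + 1"
      using assms k by (simp add: card_cart_basis)
    then have "X \<in> codes_t t (k - 1)"
      if "vec.subspace X" "vec.dim X = k - 1" "L X \<subseteq> codes_t t k" for X
      using codes_t_of_points_between(1)[of X "k - 1" UNIV t] that \<open>0 < k\<close>
      unfolding L_def by auto
    then have "\<forall>l\<in>lines ?G. l \<subseteq> codes_t t k \<longrightarrow> l \<in> lines ?P"
      unfolding P G by blast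
    moreover have "lines ?P \<subseteq> lines ?G"
      unfolding P G codes_t_def linear_codes_def by blast
    ultimately show ?thesis by blast
  qed
  moreover have "{p \<in> codes_t t k. p \<in> l} = l" if "l \<subseteq> codes_t t k" for l :: "('a ^ 'n) set set"
    using that by blast
  ultimately show ?thesis
    using points unfolding transparent_embedding_def geometry_embedding_def by auto
qed

end
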